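(* Let $w$ and $w'$ be two Dyck paths in $\mathscr{D}_n$ such that $w$ is smaller than (or equal to) $w'$ in the comb partial order. Then $w\leq w'$ in the dexter order.
   Context: A Dyck path of size $n\geq 0$ is a word of length $2n$ in the letters $0,1$ with $n$ letters $1$ and $n$ letters $0$ such that every prefix contains at least as many $1$'s as $0$'s (the height after a prefix is its number of $1$'s minus its number of $0$'s). Let $\mathscr{D}_n$ be the set of Dyck paths of size $n$. A subpath of a Dyck path $w$ is a non-empty sequence $x$ of consecutive letters of $w$ that starts and ends at the same height and stays strictly above that height in between. A subpath $x$ is movable in $w$ if it is immediately preceded in $w$ by the letter $0$ and either $x$ ends at the last letter of $w$ or $x$ is immediately followed in $w$ by the letter $1$. For a movable subpath $x$, let $N=N(w,x)\geq 1$ be the number of consecutive letters $0$ just before $x$, so $w=a\,0^{N}\,x\,b$ where $a$ does not end with $0$; for $1\leq i\leq N$ let $M(w,x,i)=a\,0^{N-i}\,x\,0^{i}\,b\in\mathscr{D}_n$. Let $\Gamma_n$ be the directed graph on $\mathscr{D}_n$ with edges $w\to M(w,x,i)$ for all movable $x$ in $w$ and all $1\leq i\leq N(w,x)$. The dexter order is: $u\leq v$ if and only if there is a directed path (possibly of length $0$) from $u$ to $v$ in $\Gamma_n$. This is a partial order whose cover relations are exactly the edges of $\Gamma_n$. The comb partial order (of Pallo) on $\mathscr{D}_n$ is the reflexive-transitive closure of the moves $a\,0\,x\,b\to a\,x\,0\,b$, where $x$ is a subpath of the Dyck path $a\,0\,x\,b$ (immediately preceded by a letter $0$) that starts and ends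 at height $0$. *)

theory Defs
  imports Main
begin

text \<open>Words are lists over the natural numbers with letters \<open>0\<close> and \<open>1\<close>.\<close>

definition height :: "nat list \<Rightarrow> int" where
  "height p = int (count_list p 1) - int (count_list p 0)"

definition dyck_paths :: "nat \<Rightarrow> nat list set" where
  "dyck_paths n = {w. set w \<subseteq> {0, 1} \<and> length w = 2 * n \<and>
     count_list w 1 = n \<and> count_list w 0 = n \<and>
     (\<forall>k\<le>length w. count_list (take k w) 0 \<le> count_list (take k w) 1)}"

text \<open>
  A subpath of \<open>w\<close> is an occurrence of a factor, not merely a word; it is represented by the
  factorization \<open>w = p @ x @ q\<close>. The predicates below take the prefix \<open>p\<close>, the factor \<open>x\<close> and
  (where needed) the suffix \<open>q\<close>.
\<close>

definition is_subpath :: "nat list \<Rightarrow> nat list \<Rightarrow> bool" where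
  "is_subpath p x \<longleftrightarrow> x \<noteq> [] \<and> height (p @ x) = height p \<and>
     (\<forall>k. 0 < k \<and> k < length x \<longrightarrow> height p < height (p @ take k x))"

definition movable :: "nat list \<Rightarrow> nat list \<Rightarrow> nat list \<Rightarrow> bool" where
  "movable p x q \<longleftrightarrow> is_subpath p x \<and> p \<noteq> [] \<and> last p = 0 \<and> (q = [] \<or> hd q = 1)"

text \<open>
  In \<open>dexter_edge\<close> the condition that \<open>a\<close> does not end with \<open>0\<close> makes \<open>N\<close> the number of
  consecutive letters \<open>0\<close> just before \<open>x\<close>, and \<open>v\<close> is the path written \<open>M(w,x,i)\<close>.
\<close>

definition dexter_edge :: "nat \<Rightarrow> nat list \<Rightarrow> nat list \<Rightarrow> bool" where
  "dexter_edge n w v \<longleftrightarrow> w \<in> dyck_paths n \<and>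
     (\<exists>a N x b i. w = a @ replicate N 0 @ x @ b \<and> (a = [] \<or> last a \<noteq> 0) \<and>
        movable (a @ replicate N 0) x b \<and> 1 \<le> i \<and> i \<le> N \<and>
        v = a @ replicate (N - i) 0 @ x @ replicate i 0 @ b)"

definition dexter_le :: "nat \<Rightarrow> nat list \<Rightarrow> nat list \<Rightarrow> bool" where
  "dexter_le n u v \<longleftrightarrow> u \<in> dyck_paths n \<and> v \<in> dyck_paths n \<and> (dexter_edge n)\<^sup>*\<^sup>* u v"

definition comb_move :: "nat \<Rightarrow> nat list \<Rightarrow> nat list \<Rightarrow> bool" where
  "comb_move n w v \<longleftrightarrow> w \<in> dyck_paths n \<and>
     (\<exists>a x b. w = a @ [0] @ x @ b \<and> is_subpath (a @ [0]) x \<and> height (a @ [0]) = 0 \<and>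
        v = a @ x @ [0] @ b)"

definition comb_le :: "nat \<Rightarrow> nat list \<Rightarrow> nat list \<Rightarrow> bool" where
  "comb_le n u v \<longleftrightarrow> u \<in> dyck_paths n \<and> v \<in> dyck_paths n \<and> (comb_move n)\<^sup>*\<^sup>* u v"

text \<open>
  The definitions of the edges only require the source to be a Dyck path; the next lemmas show
  that the targets are Dyck paths as well, so both relations live on \<open>dyck_paths n\<close>.
\<close>

lemma height_append: "height (p @ q) = height p + height q"
  by (simp add: height_def)

lemma height_replicate: "height (replicate m 0) = - int m"
  by (induction m) (auto simp: height_def)

lemma dyck_iff:
  "w \<in> dyck_paths n \<longleftrightarrow> set w \<subseteq> {0, 1} \<and> length w = 2 * n \<and>
     count_list w 1 = n \<and> count_list w 0 = n \<and> (\<forall>p q. w = p @ q \<longrightarrow> 0 \<le> height p)"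
proof -
  have "(\<forall>k\<le>length w. count_list (take k w) 0 \<le> count_list (take k w) 1) \<longleftrightarrow>
        (\<forall>p q. w = p @ q \<longrightarrow> 0 \<le> height p)"
  proof (intro iffI allI impI)
    fix p q
    assume *: "\<forall>k\<le>length w. count_list (take k w) 0 \<le> count_list (take k w) 1" "w = p @ q"
    from *(1)[rule_format, of "length p"] *(2) show "0 \<le> height p"
      by (simp add: height_def)
  next
    fix k
    assume *: "\<forall>p q. w = p @ q \<longrightarrow> 0 \<le> height p"
    then have "0 \<le> height (take k w)" using append_take_drop_id[of k w] by metis
    then show "count_list (take k w) 0 \<le> count_list (take k w) 1"
      by (simp add: height_def)
  qed
  then show ?thesis by (auto simp: dyck_paths_def)
qed

lemma subpath_prefix_height:
  assumes "is_subpath p x" "x = y @ z"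
  shows "0 \<le> height y"
proof -
  consider "y = []" | "z = []" | "0 < length y" "length y < length x"
    using assms(2) by fastforce
  then show ?thesis
  proof cases
    case 3
    then have "height p < height (p @ take (length y) x)"
      using assms(1) by (auto simp: is_subpath_def)
    then show ?thesis using assms(2) by (simp add: height_append)
  qed (use assms in \<open>auto simp: is_subpath_def height_append height_def\<close>)
qed

lemma move_zeros_dyck:
  assumes w: "a @ replicate i 0 @ x @ b \<in> dyck_paths n"
    and x: "is_subpath (a @ replicate i 0) x"
  shows "a @ x @ replicate i 0 @ b \<in> dyck_paths n"
proof -
  have pre: "0 \<le> height p" if "a @ replicate i 0 @ x @ b = p @ q" for p q
    using w that unfolding dyck_iff by blast
  have hx: "height x = 0" using x by (simp add: is_subpath_def height_append)
  have ai: "0 \<le> height a - int i"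
    using pre[of "a @ replicate i 0" "x @ b"] by (simp add: height_append height_replicate)
  have "0 \<le> height p" if eq: "a @ x @ replicate i 0 @ b = p @ q" for p q
  proof -
    from eq consider
        us where "a = p @ us"
      | us vs where "p = a @ us" "x = us @ vs"
      | us vs where "p = a @ x @ us" "replicate i 0 = us @ vs"
      | us where "p = a @ x @ replicate i 0 @ us" "b = us @ q"
      by (auto simp: append_eq_append_conv2)
    then show ?thesis
    proof cases
      case 1
      then show ?thesis using pre[of p] by simp
    next
      case 2
      then show ?thesis using subpath_prefix_height[OF x] ai by (simp add: height_append)
    next
      case 3
      then have "us = replicate (length us) 0" "length us \<le> i"
        by (metis append_eq_conv_conj length_replicate take_replicate min.absorb_iff1
            length_append le_add1 min.commute)+
      then show ?thesis using 3 hx ai height_replicate[of "length us"]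
        by (simp add: height_append)
    next
      case 4
      then show ?thesis using pre[of "a @ replicate i 0 @ x @ us" q]
        by (simp add: height_append)
    qed
  qed
  then show ?thesis using w unfolding dyck_iff by (auto simp: ac_simps)
qed

lemma dexter_edge_dyck:
  assumes "dexter_edge n w v"
  shows "w \<in> dyck_paths n" "v \<in> dyck_paths n"
proof -
  from assms obtain a N x b i where *: "w \<in> dyck_paths n" "w = a @ replicate N 0 @ x @ b"
      "movable (a @ replicate N 0) x b" "i \<le> N"
      "v = a @ replicate (N - i) 0 @ x @ replicate i 0 @ b"
    unfolding dexter_edge_def by blast
  have "replicate N (0::nat) = replicate (N - i) 0 @ replicate i 0"
    using *(4) by (metis le_add_diff_inverse2 replicate_add)
  then show "v \<in> dyck_paths n"
    using move_zeros_dyck[of "a @ replicate (N - i) 0" i x b n] * by (simp add: movable_def)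
  show "w \<in> dyck_paths n" by fact
qed

lemma comb_move_dyck:
  assumes "comb_move n w v"
  shows "w \<in> dyck_paths n" "v \<in> dyck_paths n"
  using assms move_zeros_dyck[of _ 1] by (auto simp: comb_move_def)

end

theory Submission
  imports Defs
begin

text \<open>
  A comb move is a dexter edge with \<open>i = 1\<close>: the subpath starts and ends at height \<open>0\<close>, so the
  letter after it cannot be \<open>0\<close>, and the subpath is therefore movable.
\<close>

text \<open>Needed because \<open>dexter_edge\<close> asks for the whole maximal block of zeros
  before the subpath, whereas \<open>comb_move\<close> exhibits only its last zero.\<close>

lemma obtain_trailing_replicate:
  obtains ys k where "xs = ys @ replicate k c" "ys = [] \<or> last ys \<noteq> c"
proof -
  have "\<exists>ys k. xs = ys @ replicate k c \<and> (ys = [] \<or> last ys \<noteq> c)"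
  proof (induction xs rule: rev_induct)
    case Nil
    show ?case by simp
  next
    case (snoc x xs)
    show ?case
    proof (cases "x = c")
      case True
      from snoc obtain ys k where "xs = ys @ replicate k c" "ys = [] \<or> last ys \<noteq> c"
        by blast
      then have "xs @ [x] = ys @ replicate (Suc k) c"
        using True by (simp add: replicate_append_same)
      with \<open>ys = [] \<or> last ys \<noteq> c\<close> show ?thesis by blast
    next
      \<comment> \<open>A last letter other than \<open>c\<close> makes the trailing block
        empty.\<close>
      case False
      then show ?thesis by (intro exI[of _ "xs @ [x]"] exI[of _ 0]) simp
    qed
  qed
  then show ?thesis using that by blast
qed

text \<open>A letter \<open>0\<close> right after \<open>p\<close> would take the path down to
  height -1.\<close>

lemma dyck_hd_at_height_zero:
  assumes "p @ q \<in> dyck_paths n" "height p = 0" "q \<noteq> []"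
  shows "hd q = 1"
proof -
  from assms(3) obtain c r where q: "q = c # r" by (cases q) auto
  have "0 \<le> height (p @ [c])" using assms(1) q by (simp add: dyck_iff)
  then have "c \<noteq> 0" using assms(2) by (auto simp: height_append height_def split: if_splits)
  moreover have "c \<in> {0, 1}" using assms(1) q by (auto simp: dyck_iff)
  ultimately show ?thesis using q by simp
qed

lemma comb_move_imp_dexter_edge:
  assumes "comb_move n w v"
  shows "dexter_edge n w v"
proof -
  from assms obtain a x b where w: "w \<in> dyck_paths n" "w = a @ [0] @ x @ b"
    and x: "is_subpath (a @ [0]) x" "height (a @ [0]) = 0" and v: "v = a @ x @ [0] @ b"
    unfolding comb_move_def by blast
  obtain a' k where a: "a = a' @ replicate k 0" "a' = [] \<or> last a' \<noteq> 0"
    by (rule obtain_trailing_replicate)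
  \<comment> \<open>The zero to be moved joins the \<open>k\<close> trailing zeros of
    \<open>a\<close>, so the block before \<open>x\<close> has \<open>N = Suc k\<close>.\<close>
  have a0: "a @ [0] = a' @ replicate (Suc k) 0"
    using a(1) by (simp add: replicate_append_same)
  \<comment> \<open>The subpath returns to its starting height, so \<open>b\<close>, if non-empty,
    begins at height 0 and hence with the letter 1.\<close>
  have "height (a @ [0] @ x) = 0"
    using x by (simp add: is_subpath_def)
  then have "b = [] \<or> hd b = 1"
    using dyck_hd_at_height_zero[of "a @ [0] @ x" b n] w by auto
  then have "movable (a' @ replicate (Suc k) 0) x b"
    unfolding movable_def a0[symmetric] using x(1) by simp
  moreover have "w = a' @ replicate (Suc k) 0 @ x @ b"
    using w(2) a0 by (metis append.assoc)
  \<comment> \<open>With \<open>i = 1\<close>, one zero passes behind \<open>x\<close> and the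
    \<open>k\<close> zeros of \<open>a\<close> stay in front.\<close>
  moreover have "v = a' @ replicate (Suc k - 1) 0 @ x @ replicate 1 0 @ b"
    using v a(1) by simp
  ultimately show ?thesis
    unfolding dexter_edge_def using w(1) a(2)
    by (intro conjI exI[of _ a'] exI[of _ "Suc k"] exI[of _ x] exI[of _ b] exI[of _ 1]) auto
qed

theorem proposition1p7:
  fixes n :: nat and w w' :: "nat list"
  assumes "w \<in> dyck_paths n" and "w' \<in> dyck_paths n"
    and "comb_le n w w'"
  shows "dexter_le n w w'"
proof -
  \<comment> \<open>Inclusion of one-step relations carries over to their reflexive-transitive
    closures.\<close>
  have "(dexter_edge n)\<^sup>*\<^sup>* w w'"
    using assms(3) comb_move_imp_dexter_edge rtranclp_mono[of "comb_move n" "dexter_edge n"]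
    unfolding comb_le_def by blast
  with assms(1,2) show ?thesis by (simp add: dexter_le_def)
qed

end
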